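(* There is no deterministic online algorithm for the discrete data-center optimization problem that achieves a competitive ratio $c<3$.
   Context: Discrete data-center optimization problem: given $T,m\in\mathbb{N}$, $\beta>0$ and convex functions $f_1,\dots,f_T:\{0,\dots,m\}\to\mathbb{R}_{\ge0}$, a schedule $X=(x_1,\dots,x_T)\in\{0,\dots,m\}^T$ with $x_0=0$ has cost $\sum_{t=1}^T f_t(x_t)+\beta\sum_{t=1}^T(x_t-x_{t-1})^+$, $(y)^+=\max(0,y)$. In the online version, at time $t$ the algorithm knows only $f_1,\dots,f_t$ (and $m,\beta$) and must choose $x_t$ irrevocably. An online algorithm has competitive ratio $c$ (is $c$-competitive) if on every instance its cost is at most $c$ times the cost of an optimal (offline) schedule. *)

theory Defs
  imports Complex_Main "HOL-Library.FuncSet"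
begin

text \<open>Convexity on a set of naturals that need not be an interval of reals: the usual inequality is
  required whenever the convex combination is itself a point of the set.\<close>

definition discrete_convex_on :: "nat set \<Rightarrow> (nat \<Rightarrow> real) \<Rightarrow> bool" where
  "discrete_convex_on S f \<longleftrightarrow>
    (\<forall>x\<in>S. \<forall>y\<in>S. \<forall>z\<in>S. \<forall>u v :: real.
      u \<ge> 0 \<longrightarrow> v \<ge> 0 \<longrightarrow> u + v = 1 \<longrightarrow> real z = u * real x + v * real y \<longrightarrow>
      f z \<le> u * f x + v * f y)"

text \<open>The extensional function space is used so that a cost function carries no information beyond
  its values on \<open>{0..m}\<close>; otherwise an online algorithm could read off values outside the domain.\<close>

definition cost_functions :: "nat \<Rightarrow> (nat \<Rightarrow> real) set" where
  "cost_functions m = {f \<in> {0..m} \<rightarrow>\<^sub>E {0..}. discrete_convex_on {0..m} f}"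

text \<open>Here \<open>f t\<close> is the cost function arriving at time \<open>t\<close>; only \<open>t \<in> {1..T}\<close> is relevant.\<close>

definition dc_instance :: "nat \<Rightarrow> nat \<Rightarrow> real \<Rightarrow> (nat \<Rightarrow> nat \<Rightarrow> real) \<Rightarrow> bool" where
  "dc_instance T m \<beta> f \<longleftrightarrow> T \<ge> 1 \<and> m \<ge> 1 \<and> \<beta> > 0 \<and> (\<forall>t\<in>{1..T}. f t \<in> cost_functions m)"

text \<open>Values of a schedule after time \<open>T\<close> are unconstrained and do not enter its cost.\<close>

definition schedules :: "nat \<Rightarrow> nat \<Rightarrow> (nat \<Rightarrow> nat) set" where
  "schedules T m = {x. x 0 = 0 \<and> (\<forall>t\<in>{1..T}. x t \<in> {0..m})}"

definition cost :: "nat \<Rightarrow> real \<Rightarrow> (nat \<Rightarrow> nat \<Rightarrow> real) \<Rightarrow> (nat \<Rightarrow> nat) \<Rightarrow> real" where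
  "cost T \<beta> f x =
    (\<Sum>t=1..T. f t (x t)) + \<beta> * (\<Sum>t=1..T. max 0 (real (x t) - real (x (t - 1))))"

definition optimal_schedule ::
    "nat \<Rightarrow> nat \<Rightarrow> real \<Rightarrow> (nat \<Rightarrow> nat \<Rightarrow> real) \<Rightarrow> (nat \<Rightarrow> nat) \<Rightarrow> bool" where
  "optimal_schedule T m \<beta> f y \<longleftrightarrow> is_arg_min (cost T \<beta> f) (\<lambda>x. x \<in> schedules T m) y"

lemma optimal_schedule_exists: "\<exists>y. optimal_schedule T m \<beta> f y"
proof -
  define S where "S = {x \<in> {0..T} \<rightarrow>\<^sub>E {0..m}. x 0 = 0}"
  have "finite S"
    unfolding S_def by (simp add: finite_PiE)
  moreover have restr: "restrict x {0..T} \<in> S" if "x \<in> schedules T m" for x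
  proof -
    have "x t \<le> m" if "t \<le> T" for t
      using that \<open>x \<in> schedules T m\<close> by (cases "t = 0") (auto simp: schedules_def)
    thus ?thesis
      using \<open>x \<in> schedules T m\<close> by (auto simp: S_def schedules_def)
  qed
  moreover have "(\<lambda>_. 0) \<in> schedules T m"
    by (simp add: schedules_def)
  ultimately obtain y where y: "is_arg_min (cost T \<beta> f) (\<lambda>x. x \<in> S) y"
    using ex_is_arg_min_if_finite[of S "cost T \<beta> f"] by blast
  have "cost T \<beta> f y \<le> cost T \<beta> f z" if "z \<in> schedules T m" for z
  proof -
    have "cost T \<beta> f y \<le> cost T \<beta> f (restrict z {0..T})"
      using y restr[OF that] by (auto simp: is_arg_min_linorder)
    also have "\<dots> = cost T \<beta> f z"
      unfolding cost_def by (intro arg_cong2[of _ _ _ _ "(+)"] arg_cong2[of _ _ _ _ "(*)"] sum.cong) auto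
    finally show ?thesis .
  qed
  moreover have "y \<in> schedules T m"
    using y by (auto simp: is_arg_min_def S_def schedules_def PiE_iff)
  ultimately show ?thesis
    by (auto simp: optimal_schedule_def is_arg_min_linorder)
qed

text \<open>A deterministic online algorithm maps \<open>m\<close>, \<open>\<beta>\<close> and the list \<open>[f\<^sub>1, \<dots>, f\<^sub>t]\<close> of the cost
  functions revealed so far to the state \<open>x\<^sub>t\<close>. It sees neither the horizon \<open>T\<close> nor any later cost
  function; its own earlier states are determined by the prefixes of the list.\<close>

type_synonym online_strategy = "nat \<Rightarrow> real \<Rightarrow> (nat \<Rightarrow> real) list \<Rightarrow> nat"

definition online_schedule ::
    "online_strategy \<Rightarrow> nat \<Rightarrow> real \<Rightarrow> (nat \<Rightarrow> nat \<Rightarrow> real) \<Rightarrow> nat \<Rightarrow> nat" where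
  "online_schedule A m \<beta> f t = (if t = 0 then 0 else A m \<beta> (map f [1..<Suc t]))"

definition online_algorithm :: "online_strategy \<Rightarrow> bool" where
  "online_algorithm A \<longleftrightarrow>
    (\<forall>T m \<beta> f. dc_instance T m \<beta> f \<longrightarrow> online_schedule A m \<beta> f \<in> schedules T m)"

definition competitive :: "real \<Rightarrow> online_strategy \<Rightarrow> bool" where
  "competitive c A \<longleftrightarrow>
    (\<forall>T m \<beta> f y. dc_instance T m \<beta> f \<longrightarrow> optimal_schedule T m \<beta> f y \<longrightarrow>
      cost T \<beta> f (online_schedule A m \<beta> f) \<le> c * cost T \<beta> f y)"

end

theory Submission
  imports Defs
begin

text \<open>
  Take \<open>m = 1\<close> and \<open>\<beta> = 2\<close>. The adversary always charges a small \<open>\<epsilon>\<close> for the state that the algorithm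
  currently occupies and nothing for the other one. The algorithm is compared with three offline
  schedules: staying at 0, staying at 1, and always being in the state that the algorithm has just
  not occupied. In each step the first two together pay \<open>\<epsilon>\<close>, and the third pays no operating cost
  and, up to a constant, the switching cost of the algorithm. So the three costs add up to at most
  \<open>1 + \<epsilon>\<close> times the cost of the algorithm plus a constant, and the cheapest of them is about a
  third of the cost of the algorithm, which itself grows without bound.
\<close>

lemma cost_0 [simp]: "cost 0 \<beta> f x = 0"
  by (simp add: cost_def)

lemma cost_Suc:
  "cost (Suc n) \<beta> f x =
    cost n \<beta> f x + f (Suc n) (x (Suc n)) + \<beta> * max 0 (real (x (Suc n)) - real (x n))"
  by (simp add: cost_def algebra_simps)

lemma cost_optimal_le:
  "optimal_schedule T m \<beta> f y \<Longrightarrow> z \<in> schedules T m \<Longrightarrow> cost T \<beta> f y \<le> cost T \<beta> f z"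
  by (auto simp: optimal_schedule_def is_arg_min_linorder)

lemma cost_nonneg:
  assumes "dc_instance T m \<beta> f" "x \<in> schedules T m"
  shows "cost T \<beta> f x \<ge> 0"
proof -
  have "f t (x t) \<ge> 0" if "t \<in> {1..T}" for t
    using assms that by (fastforce simp: dc_instance_def cost_functions_def schedules_def)
  thus ?thesis
    using assms unfolding cost_def dc_instance_def
    by (intro add_nonneg_nonneg mult_nonneg_nonneg sum_nonneg) auto
qed

text \<open>Recursion over the list of revealed functions breaks a circularity: each new function
  depends on the algorithm's reply to the earlier ones.\<close>

fun adversary_history ::
    "((nat \<Rightarrow> real) list \<Rightarrow> nat) \<Rightarrow> (nat \<Rightarrow> nat \<Rightarrow> real) \<Rightarrow> nat \<Rightarrow> (nat \<Rightarrow> real) list" where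
  "adversary_history a g 0 = []"
| "adversary_history a g (Suc t) = (let h = adversary_history a g t in
     h @ [g (if t = 0 then 0 else a h)])"

lemma adaptive_adversary_exists:
  obtains f where "\<And>t. f (Suc t) = g (online_schedule A m \<beta> f t)"
proof
  fix t
  define h where "h = adversary_history (A m \<beta>) g"
  define f where "f t = last (h t)" for t
  have hist: "map f [1..<Suc t] = h t" for t
    by (induction t) (auto simp: f_def h_def Let_def)
  show "f (Suc t) = g (online_schedule A m \<beta> f t)"
    unfolding online_schedule_def hist by (simp add: f_def h_def Let_def)
qed

definition penalty :: "real \<Rightarrow> nat \<Rightarrow> nat \<Rightarrow> real" where
  "penalty \<epsilon> s = (\<lambda>x\<in>{0..1}. if x = s then \<epsilon> else 0)"

text \<open>No natural number lies strictly between 0 and 1, so only trivial combinations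
  arise.\<close>

lemma discrete_convex_on_01: "discrete_convex_on {0..1} f"
  unfolding discrete_convex_on_def
proof (intro ballI allI impI)
  fix x y z :: nat and u v :: real
  assume "x \<in> {0..1}" "y \<in> {0..1}" "z \<in> {0..1}" "u \<ge> 0" "v \<ge> 0" and uv: "u + v = 1"
    and z: "real z = u * real x + v * real y"
  then consider "x = y" | "x = 0" "y = 1" | "x = 1" "y = 0"
    by fastforce
  thus "f z \<le> u * f x + v * f y"
  proof cases
    case 1
    hence "real z = real x" "u * f x + v * f y = f x"
      using uv z by (simp_all flip: distrib_right)
    thus ?thesis
      by simp
  qed (use uv z \<open>z \<in> {0..1}\<close> in \<open>auto simp: le_Suc_eq\<close>)
qed

lemma penalty_cost_function: "\<epsilon> \<ge> 0 \<Longrightarrow> penalty \<epsilon> s \<in> cost_functions 1"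
  unfolding cost_functions_def using discrete_convex_on_01 by (auto simp: penalty_def)

context
  fixes \<epsilon> :: real and f :: "nat \<Rightarrow> nat \<Rightarrow> real" and x :: "nat \<Rightarrow> nat"
  assumes eps: "0 \<le> \<epsilon>" "\<epsilon> \<le> 1"
    and x0: "x 0 = 0"
    and x01: "\<And>t. x t \<le> 1"
    and f_eq: "\<And>t. f (Suc t) = penalty \<epsilon> (x t)"
begin

lemma x_cases:
  obtains "x n = 0" | "x n = 1"
  using x01[of n] by linarith

text \<open>The term \<open>x n\<close> is a potential: a move up costs 2, enough for its own step
  and, as \<open>\<epsilon> \<le> 1\<close>, for the later free move down.\<close>

lemma chased_cost_ge: "cost n 2 f x \<ge> \<epsilon> * n + x n"
proof (induction n)
  case (Suc n)
  thus ?case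
    using eps by (cases n rule: x_cases; cases "Suc n" rule: x_cases)
      (auto simp: cost_Suc f_eq penalty_def algebra_simps)
qed (simp add: x0)

lemma chased_cost_mono: "cost n 2 f x \<le> cost (Suc n) 2 f x"
  using eps x01[of "Suc n"] by (auto simp: cost_Suc f_eq penalty_def)

text \<open>The third schedule lags one step behind, so it is compared at time \<open>n + 1\<close> with the algorithm at
  time \<open>n\<close>. The term \<open>(2 + \<epsilon>) * x n\<close> is a potential: only upward moves are charged, so the
  algorithm pays on its way up for what the third schedule pays when the algorithm goes down.\<close>

lemma three_offline_costs:
  "cost (Suc n) 2 f (\<lambda>_. 0) + cost (Suc n) 2 f (\<lambda>t. if t = 0 then 0 else 1)
     + cost (Suc n) 2 f (\<lambda>t. if t = 0 then 0 else 1 - x (t - 1))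
   \<le> (1 + \<epsilon>) * cost n 2 f x + 5 - (2 + \<epsilon>) * x n"
proof (induction n)
  case 0
  \<comment> \<open>Two schedules rise to 1 for 2 each and the one at 0 pays
    \<open>\<epsilon>\<close>, in all at most 5.\<close>
  show ?case
    using eps by (simp add: cost_Suc f_eq penalty_def x0)
next
  \<comment> \<open>When the algorithm moves, both sides grow equally; on its way up,
    \<open>2 * (1 + \<epsilon>) - (2 + \<epsilon>) = \<epsilon>\<close>.\<close>
  case (Suc n)
  show ?case
    using Suc eps unfolding cost_Suc[of "Suc n"] cost_Suc[of n _ _ x]
    by (cases n rule: x_cases; cases "Suc n" rule: x_cases)
      (simp_all add: f_eq penalty_def algebra_simps add_increasing)
qed

lemma chased_cost_optimal:
  assumes "optimal_schedule (Suc n) 1 2 f y"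
  shows "3 * cost (Suc n) 2 f y \<le> (1 + \<epsilon>) * cost (Suc n) 2 f x + 5"
proof -
  have "3 * cost (Suc n) 2 f y \<le> (1 + \<epsilon>) * cost n 2 f x + 5 - (2 + \<epsilon>) * x n"
    using three_offline_costs[of n]
      cost_optimal_le[OF assms, of "\<lambda>_. 0"]
      cost_optimal_le[OF assms, of "\<lambda>t. if t = 0 then 0 else 1"]
      cost_optimal_le[OF assms, of "\<lambda>t. if t = 0 then 0 else 1 - x (t - 1)"]
    by (simp add: schedules_def)
  moreover have "(1 + \<epsilon>) * cost n 2 f x \<le> (1 + \<epsilon>) * cost (Suc n) 2 f x"
    using eps chased_cost_mono by (intro mult_left_mono) auto
  moreover have "(2 + \<epsilon>) * x n \<ge> 0"
    using eps by simp
  ultimately show ?thesis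
    by linarith
qed

end

lemma not_competitive_below_3:
  assumes A: "online_algorithm A" and c: "1 \<le> c" "c < 3"
  shows "\<not> competitive c A"
proof
  assume comp: "competitive c A"
  \<comment> \<open>This makes
    \<open>c * (1 + \<epsilon>) = 3 - 3 * \<epsilon> - 6 * \<epsilon>^2\<close>, which is below
    3.\<close>
  define \<epsilon> where "\<epsilon> = (3 - c) / 6"
  have eps: "0 < \<epsilon>" "\<epsilon> \<le> 1" and c_eps: "c = 3 - 6 * \<epsilon>"
    using c by (auto simp: \<epsilon>_def field_simps)
  obtain f where f: "\<And>t. f (Suc t) = penalty \<epsilon> (online_schedule A 1 2 f t)"
    using adaptive_adversary_exists by blast
  define x where "x = online_schedule A 1 2 f"
  have inst: "dc_instance T 1 2 f" if "T \<ge> 1" for T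
    unfolding dc_instance_def
  proof (intro conjI ballI)
    fix t assume "t \<in> {1..T}"
    then obtain s where "t = Suc s"
      by (cases t) auto
    thus "f t \<in> cost_functions 1"
      using f penalty_cost_function eps by simp
  qed (use that in auto)
  have x0: "x 0 = 0"
    by (simp add: x_def online_schedule_def)
  have x01: "x t \<le> 1" for t
  proof (cases "t = 0")
    case False
    hence "x \<in> schedules t 1"
      using A inst[of t] by (simp add: online_algorithm_def x_def)
    thus ?thesis
      using False by (auto simp: schedules_def)
  qed (simp add: x0)
  note chased = eps(1)[THEN less_imp_le] eps(2) x0 x01 f[folded x_def]

  \<comment> \<open>So long a run forces \<open>\<epsilon> * a > 5\<close> for the algorithm's cost
    \<open>a\<close>, while competitiveness will give
    \<open>3 * (\<epsilon> * a) \<le> 15\<close>.\<close>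
  obtain n where n: "5 / \<epsilon>\<^sup>2 < real n"
    using reals_Archimedean2 by blast
  obtain y where y: "optimal_schedule (Suc n) 1 2 f y"
    using optimal_schedule_exists by blast
  define a where "a = cost (Suc n) 2 f x"
  have "3 * a \<le> c * (3 * cost (Suc n) 2 f y)"
    using comp inst[of "Suc n"] y by (auto simp: competitive_def a_def x_def)
  also have "\<dots> \<le> c * ((1 + \<epsilon>) * a + 5)"
    using chased_cost_optimal[where x = x and f = f and \<epsilon> = \<epsilon>, OF chased y] c
    by (intro mult_left_mono) (auto simp: a_def)
  finally have upper: "3 * (\<epsilon> * a) + 6 * \<epsilon>\<^sup>2 * a + 30 * \<epsilon> \<le> 15"
    by (simp add: c_eps algebra_simps power2_eq_square)
  have a_ge: "\<epsilon> * real n \<le> a"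
    using chased_cost_ge[where x = x and f = f and \<epsilon> = \<epsilon>, OF chased, of "Suc n"] eps
    by (simp add: a_def algebra_simps)
  have "5 < \<epsilon> * (\<epsilon> * real n)"
    using n eps by (simp add: field_simps power2_eq_square)
  also have "\<dots> \<le> \<epsilon> * a"
    using a_ge eps by simp
  finally have "5 < \<epsilon> * a" .
  moreover have "6 * \<epsilon>\<^sup>2 * a \<ge> 0"
    using a_ge eps by (simp add: order.trans[OF _ a_ge])
  ultimately show False
    using upper eps by linarith
qed

lemma competitive_mono:
  assumes "competitive c A" "c \<le> d"
  shows "competitive d A"
  unfolding competitive_def
proof (intro allI impI)
  fix T m \<beta> f y
  assume *: "dc_instance T m \<beta> f" "optimal_schedule T m \<beta> f y"
  have "cost T \<beta> f (online_schedule A m \<beta> f) \<le> c * cost T \<beta> f y"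
    using assms(1) * by (simp add: competitive_def)
  also have "\<dots> \<le> d * cost T \<beta> f y"
    using * assms(2) cost_nonneg[of T m \<beta> f y]
    by (intro mult_right_mono) (auto simp: optimal_schedule_def is_arg_min_def)
  finally show "cost T \<beta> f (online_schedule A m \<beta> f) \<le> d * cost T \<beta> f y" .
qed

theorem theorem5p1:
  shows "\<not> (\<exists>(A :: online_strategy) (c :: real). online_algorithm A \<and> c < 3 \<and> competitive c A)"
proof
  assume "\<exists>(A :: online_strategy) c :: real. online_algorithm A \<and> c < 3 \<and> competitive c A"
  then obtain A c where "online_algorithm A" "c < 3" "competitive c A"
    by blast
  \<comment> \<open>Raising \<open>c\<close> to at least 1 keeps it below 3 and makes
    \<open>not_competitive_below_3\<close> applicable.\<close>
  thus False
    using competitive_mono[of c A "max c 1"] not_competitive_below_3[of A "max c 1"] by simp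
qed

end
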